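(* Let $1\le s\le n$ be integers. The preference functions $\psi:[n]\to[s]$ (for $n$ cars parking on a street with $s$ spots) having the minimum possible defect $n-s$ are in bijection with the $[s]$-restricted parking functions on $n$ cars, i.e. with the set $\mathrm{PF}_{n\mid[s]}$.
   Context: $[m]=\{1,\dots,m\}$. Parking procedure: $n$ cars, numbered $1,\dots,n$, enter in order a one-way street with $s$ spots numbered $1,\dots,s$. Given a preference function $\psi:[n]\to[s]$, car $i$ drives to spot $\psi(i)$ and parks there if it is empty; otherwise it continues down the street and parks in the first empty spot with a larger number; if there is none, it leaves without parking. The defect of $\psi$ is the number of cars that are unable to park. A parking function on $n$ cars is a function $\pi:[n]\to[n]$ for which all $n$ cars park on a street with $n$ spots under this procedure; equivalently, $\#\pi^{-1}([i])\ge i$ for every $i\in[n]$. For $S\subseteq[n]$, $\mathrm{PF}_{n\mid S}$ is the set of $S$-restricted parking functions on $n$ cars: parking functions on $n$ cars with image contained in $S$. *)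

theory Defs
  imports Main "HOL-Library.FuncSet"
begin

text \<open>A function from \<open>[n]\<close> to \<open>[s]\<close> is an element of the extensional function space
  \<open>{1..n} \<rightarrow>\<^sub>E {1..s}\<close>, so that functions agreeing on \<open>[n]\<close> are equal.\<close>

definition prefs :: "nat \<Rightarrow> nat \<Rightarrow> (nat \<Rightarrow> nat) set" where
  "prefs n s = {1..n} \<rightarrow>\<^sub>E {1..s}"

text \<open>The spot taken on a street with spots \<open>1, \<dots>, s\<close> by a car with preference \<open>p\<close> when the spots
  in \<open>Occ\<close> are occupied; \<open>None\<close> if the car leaves without parking.\<close>

definition park_spot :: "nat \<Rightarrow> nat set \<Rightarrow> nat \<Rightarrow> nat option" where
  "park_spot s Occ p =
     (if \<exists>j\<in>{p..s}. j \<notin> Occ then Some (LEAST j. j \<in> {p..s} \<and> j \<notin> Occ) else None)"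

text \<open>The spots occupied after cars \<open>1, \<dots>, i\<close> have attempted to park.\<close>

primrec occupied :: "nat \<Rightarrow> (nat \<Rightarrow> nat) \<Rightarrow> nat \<Rightarrow> nat set" where
  "occupied s \<psi> 0 = {}"
| "occupied s \<psi> (Suc i) =
     occupied s \<psi> i \<union> set_option (park_spot s (occupied s \<psi> i) (\<psi> (Suc i)))"

definition outcome :: "nat \<Rightarrow> (nat \<Rightarrow> nat) \<Rightarrow> nat \<Rightarrow> nat option" where
  "outcome s \<psi> i = park_spot s (occupied s \<psi> (i - 1)) (\<psi> i)"

definition defect :: "nat \<Rightarrow> nat \<Rightarrow> (nat \<Rightarrow> nat) \<Rightarrow> nat" where
  "defect n s \<psi> = card {i \<in> {1..n}. outcome s \<psi> i = None}"

definition parking_functions :: "nat \<Rightarrow> (nat \<Rightarrow> nat) set" where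
  "parking_functions n = {\<pi> \<in> prefs n n. \<forall>i\<in>{1..n}. outcome n \<pi> i \<noteq> None}"

definition restricted_parking_functions :: "nat \<Rightarrow> nat set \<Rightarrow> (nat \<Rightarrow> nat) set" where
  "restricted_parking_functions n S = {\<pi> \<in> parking_functions n. \<pi> ` {1..n} \<subseteq> S}"

end

theory Submission
  imports Defs
begin

text \<open>The two sets are equal, so the bijection is the identity. The defect of \<open>\<psi>\<close> is \<open>n\<close> minus
  the number of occupied spots, hence it is minimal exactly when all of \<open>[s]\<close> gets filled. Extending
  the street from \<open>s\<close> to \<open>n\<close> spots does not change which of the first \<open>s\<close> spots are taken. If
  \<open>[s]\<close> gets filled and some car, preferring \<open>p \<le> s\<close>, failed on the longer street, then the spots
  \<open>p, \<dots>, n\<close> would be filled too, so that all \<open>n\<close> spots would be taken by fewer than \<open>n\<close> cars.\<close>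

lemma park_spot_eq_None_iff: "park_spot s A p = None \<longleftrightarrow> {p..s} \<subseteq> A"
  by (auto simp: park_spot_def)

text \<open>Trades the \<open>LEAST\<close> of the definition for an explicit condition on
  \<open>j\<close>, the form in which later proofs reason about where a car parks.\<close>

lemma park_spot_eq_Some_iff:
  "park_spot s A p = Some j \<longleftrightarrow> p \<le> j \<and> j \<le> s \<and> j \<notin> A \<and> {p..<j} \<subseteq> A"
proof
  assume "park_spot s A p = Some j"
  then have ex: "\<exists>j. j \<in> {p..s} \<and> j \<notin> A" and j: "j = (LEAST j. j \<in> {p..s} \<and> j \<notin> A)"
    by (auto simp: park_spot_def split: if_splits)
  have "j \<in> {p..s} \<and> j \<notin> A"
    unfolding j by (rule LeastI_ex) (rule ex)
  moreover have "k \<in> A" if "p \<le> k" "k < j" for k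
    using not_less_Least[of k "\<lambda>j. j \<in> {p..s} \<and> j \<notin> A", folded j] that calculation by auto
  ultimately show "p \<le> j \<and> j \<le> s \<and> j \<notin> A \<and> {p..<j} \<subseteq> A"
    by auto
next
  assume r: "p \<le> j \<and> j \<le> s \<and> j \<notin> A \<and> {p..<j} \<subseteq> A"
  have "(LEAST j. j \<in> {p..s} \<and> j \<notin> A) = j"
    using r by (intro Least_equality) (auto simp: not_less[symmetric])
  then show "park_spot s A p = Some j"
    using r by (auto simp: park_spot_def)
qed

text \<open>Whether \<open>j\<close> is the first free spot from \<open>p\<close> on depends only on
  the spots from \<open>p\<close> to \<open>j\<close>, all of which lie in \<open>{1..s}\<close>
  once \<open>j \<le> s\<close>.\<close>

lemma park_spot_truncate:
  assumes "s \<le> n" and "1 \<le> p"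
  shows "set_option (park_spot s (A \<inter> {1..s}) p) = set_option (park_spot n A p) \<inter> {1..s}"
  using assms by (fastforce simp: park_spot_eq_Some_iff)

lemma outcome_Suc: "outcome s \<psi> (Suc i) = park_spot s (occupied s \<psi> i) (\<psi> (Suc i))"
  by (simp add: outcome_def)

lemma occupied_mono: "i \<le> j \<Longrightarrow> occupied s \<psi> i \<subseteq> occupied s \<psi> j"
  by (rule lift_Suc_mono_le[of "occupied s \<psi>"]) auto

text \<open>The hypothesis excludes the preference 0, which would let a car take a spot 0.\<close>

lemma occupied_subset:
  assumes "\<And>i. i \<in> {1..n} \<Longrightarrow> 1 \<le> \<psi> i"
  shows "occupied s \<psi> n \<subseteq> {1..s}"
  using assms
proof (induction n)
  case (Suc n)
  have "1 \<le> \<psi> (Suc n)"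
    using Suc.prems by simp
  moreover have "occupied s \<psi> n \<subseteq> {1..s}"
    using Suc by simp
  ultimately show ?case
    by (auto simp: park_spot_eq_Some_iff)
qed simp

lemma defect_Suc:
  "defect (Suc n) s \<psi> = defect n s \<psi> + (if outcome s \<psi> (Suc n) = None then 1 else 0)"
proof -
  have eq: "{i \<in> {1..Suc n}. outcome s \<psi> i = None} =
      {i \<in> {1..n}. outcome s \<psi> i = None} \<union> (if outcome s \<psi> (Suc n) = None then {Suc n} else {})"
    by (auto simp: le_Suc_eq)
  show ?thesis
    unfolding defect_def eq by (subst card_Un_disjoint) (auto split: if_splits)
qed

text \<open>Each car either raises the defect by one or takes a spot that was free. Finiteness is
  carried through the induction so that inserting a new spot raises \<open>card\<close> by
  one.\<close>

lemma card_occupied_add_defect: "finite (occupied s \<psi> n) \<and> card (occupied s \<psi> n) + defect n s \<psi> = n"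
proof (induction n)
  case 0
  then show ?case by (simp add: defect_def)
next
  case (Suc n)
  show ?case
  proof (cases "outcome s \<psi> (Suc n)")
    case None
    then show ?thesis
      using Suc by (simp add: defect_Suc flip: outcome_Suc)
  next
    case (Some j)
    then have "j \<notin> occupied s \<psi> n"
      by (simp add: outcome_Suc park_spot_eq_Some_iff)
    then show ?thesis
      using Suc Some by (simp add: defect_Suc flip: outcome_Suc)
  qed
qed

lemma minimal_defect:
  assumes "s \<le> n" and "\<psi> \<in> prefs n m"
  shows "defect n s \<psi> = n - s \<longleftrightarrow> occupied s \<psi> n = {1..s}"
    and "n - s \<le> defect n s \<psi>"
proof -
  have sub: "occupied s \<psi> n \<subseteq> {1..s}"
    using assms(2) by (intro occupied_subset) (auto simp: prefs_def)
  have card_le: "card (occupied s \<psi> n) \<le> s"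
    using card_mono[OF _ sub] by simp
  have sum: "card (occupied s \<psi> n) + defect n s \<psi> = n"
    by (simp add: card_occupied_add_defect)
  show "n - s \<le> defect n s \<psi>"
    using sum card_le by linarith
  have "occupied s \<psi> n = {1..s} \<longleftrightarrow> card (occupied s \<psi> n) = s"
    using card_subset_eq[OF _ sub] by auto
  then show "defect n s \<psi> = n - s \<longleftrightarrow> occupied s \<psi> n = {1..s}"
    using sum card_le assms(1) by linarith
qed

text \<open>By induction on the cars: one that ends beyond \<open>s\<close> on the long street fails
  on the short one, and any other takes the same spot on both or fails on both.\<close>

lemma occupied_truncate:
  assumes "s \<le> n" and "\<And>i. i \<in> {1..m} \<Longrightarrow> 1 \<le> \<psi> i"
  shows "occupied s \<psi> m = occupied n \<psi> m \<inter> {1..s}"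
  using assms(2)
proof (induction m)
  case (Suc m)
  have "1 \<le> \<psi> (Suc m)"
    using Suc.prems by simp
  then show ?case
    using Suc park_spot_truncate[OF assms(1), of "\<psi> (Suc m)" "occupied n \<psi> m"]
    by (simp add: Int_Un_distrib2)
qed simp

text \<open>Car \<open>i\<close> either finds its preferred spot taken or takes it itself.\<close>

lemma preference_occupied:
  assumes "1 \<le> i" and "\<psi> i \<le> s"
  shows "\<psi> i \<in> occupied s \<psi> i"
proof (cases i)
  case (Suc k)
  show ?thesis
  proof (cases "\<psi> i \<in> occupied s \<psi> k")
    case False
    then have "park_spot s (occupied s \<psi> k) (\<psi> i) = Some (\<psi> i)"
      using assms by (simp add: park_spot_eq_Some_iff)
    then show ?thesis using Suc by simp
  qed (simp add: Suc)
qed (use assms in simp)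

lemma defect_surjective:
  assumes "s \<le> n" and "\<psi> \<in> prefs n s" and "\<psi> ` {1..n} = {1..s}"
  shows "defect n s \<psi> = n - s"
proof -
  have "\<psi> i \<in> occupied s \<psi> n" if "i \<in> {1..n}" for i
    using preference_occupied[of i \<psi> s] occupied_mono[of i n s \<psi>] that assms(2)
    by (auto simp: prefs_def PiE_iff)
  then have "{1..s} \<subseteq> occupied s \<psi> n"
    unfolding assms(3)[symmetric] by blast
  moreover have "occupied s \<psi> n \<subseteq> {1..s}"
    using assms(2) by (intro occupied_subset) (auto simp: prefs_def)
  ultimately show ?thesis
    using minimal_defect(1)[OF assms(1,2)] by blast
qed

lemma parking_functions_iff:
  "\<pi> \<in> parking_functions n \<longleftrightarrow> \<pi> \<in> prefs n n \<and> occupied n \<pi> n = {1..n}"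
proof -
  \<comment> \<open>Zero is written as \<open>n - n\<close> so that \<open>minimal_defect\<close>
    applies with \<open>s\<close> equal to \<open>n\<close>.\<close>
  have "(\<forall>i\<in>{1..n}. outcome n \<pi> i \<noteq> None) \<longleftrightarrow> defect n n \<pi> = n - n"
    by (auto simp: defect_def)
  then show ?thesis
    using minimal_defect(1)[of n n \<pi> n] by (auto simp: parking_functions_def)
qed

lemma parking_function_iff_defect:
  assumes "s \<le> n" and \<psi>: "\<psi> \<in> prefs n s"
  shows "\<psi> \<in> parking_functions n \<longleftrightarrow> defect n s \<psi> = n - s"
proof -
  have range: "1 \<le> \<psi> i \<and> \<psi> i \<le> s" if "i \<in> {1..n}" for i
    using \<psi> that by (auto simp: prefs_def PiE_iff)
  have \<psi>n: "\<psi> \<in> prefs n n"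
    using \<psi> assms(1) by (fastforce simp: prefs_def PiE_iff)
  have trunc: "occupied s \<psi> n = occupied n \<psi> n \<inter> {1..s}"
    using assms(1) range by (intro occupied_truncate) auto
  have "occupied n \<psi> n = {1..n}" if filled: "{1..s} \<subseteq> occupied n \<psi> n"
  proof (rule ccontr)
    assume "occupied n \<psi> n \<noteq> {1..n}"
    \<comment> \<open>The count of cars against spots enters here: an empty spot among the
      \<open>n\<close> spots forces one of the \<open>n\<close> cars to fail.\<close>
    then have "\<psi> \<notin> parking_functions n"
      by (simp add: parking_functions_iff)
    then obtain i where i: "i \<in> {1..n}" "outcome n \<psi> i = None"
      using \<psi>n unfolding parking_functions_def by blast
    then have "{\<psi> i..n} \<subseteq> occupied n \<psi> (i - 1)"
      by (simp add: outcome_def park_spot_eq_None_iff)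
    also have "\<dots> \<subseteq> occupied n \<psi> n"
      using i(1) by (intro occupied_mono) auto
    \<comment> \<open>Since \<open>\<psi> i \<le> s\<close>, the intervals \<open>{1..s}\<close> and
      \<open>{\<psi> i..n}\<close> leave no gap.\<close>
    finally have "{1..n} \<subseteq> occupied n \<psi> n"
      using filled range[OF i(1)] by fastforce
    moreover have "occupied n \<psi> n \<subseteq> {1..n}"
      using range by (intro occupied_subset) blast
    ultimately show False
      using \<open>occupied n \<psi> n \<noteq> {1..n}\<close> by blast
  qed
  moreover have "{1..s} \<subseteq> {1..n}"
    using assms(1) by simp
  ultimately have "occupied s \<psi> n = {1..s} \<longleftrightarrow> occupied n \<psi> n = {1..n}"
    unfolding trunc by (metis inf.absorb_iff2)
  then show ?thesis
    using \<psi>n minimal_defect(1)[OF assms] by (simp add: parking_functions_iff)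
qed

text \<open>Both function spaces are extensional on \<open>{1..n}\<close>, so a parking function
  with image in \<open>{1..s}\<close> is literally an element of \<open>prefs n s\<close>.\<close>

lemma restricted_parking_functions_eq:
  assumes "s \<le> n"
  shows "restricted_parking_functions n {1..s} = {\<psi> \<in> prefs n s. defect n s \<psi> = n - s}"
proof (intro set_eqI iffI)
  fix \<pi> assume \<pi>: "\<pi> \<in> restricted_parking_functions n {1..s}"
  then have "\<pi> \<in> prefs n s"
    by (auto simp: restricted_parking_functions_def parking_functions_def prefs_def PiE_iff)
  then show "\<pi> \<in> {\<psi> \<in> prefs n s. defect n s \<psi> = n - s}"
    using \<pi> parking_function_iff_defect[OF assms]
    by (simp add: restricted_parking_functions_def)
next
  fix \<psi> assume \<psi>: "\<psi> \<in> {\<psi> \<in> prefs n s. defect n s \<psi> = n - s}"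
  then have "\<psi> ` {1..n} \<subseteq> {1..s}"
    by (auto simp: prefs_def PiE_iff)
  then show "\<psi> \<in> restricted_parking_functions n {1..s}"
    using \<psi> parking_function_iff_defect[OF assms]
    by (simp add: restricted_parking_functions_def)
qed

theorem theorem6:
  fixes n s :: nat
  assumes "1 \<le> s" and "s \<le> n"
  shows "(\<forall>\<psi>\<in>prefs n s. n - s \<le> defect n s \<psi>)
    \<and> (\<exists>\<psi>\<in>prefs n s. defect n s \<psi> = n - s)
    \<and> (\<exists>f. bij_betw f {\<psi> \<in> prefs n s. defect n s \<psi> = n - s}
              (restricted_parking_functions n {1..s}))"
proof (intro conjI)
  show "\<forall>\<psi>\<in>prefs n s. n - s \<le> defect n s \<psi>"
    using minimal_defect(2)[OF assms(2)] by blast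
  \<comment> \<open>A preference function onto \<open>{1..s}\<close>: each \<open>k \<le> s\<close>
    is its own preimage. Every spot is then preferred by some car, so the street fills up.\<close>
  define \<psi> where "\<psi> = (\<lambda>i\<in>{1..n}. min i s)"
  have \<psi>: "\<psi> \<in> prefs n s"
    using assms by (auto simp: \<psi>_def prefs_def)
  have "k \<in> \<psi> ` {1..n}" if "k \<in> {1..s}" for k
    using that assms by (intro image_eqI[of _ _ k]) (auto simp: \<psi>_def)
  then have "\<psi> ` {1..n} = {1..s}"
    using assms by (auto simp: \<psi>_def)
  then show "\<exists>\<psi>\<in>prefs n s. defect n s \<psi> = n - s"
    using defect_surjective[OF assms(2) \<psi>] \<psi> by blast
  show "\<exists>f. bij_betw f {\<psi> \<in> prefs n s. defect n s \<psi> = n - s}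
      (restricted_parking_functions n {1..s})"
    unfolding restricted_parking_functions_eq[OF assms(2)] using bij_betw_id by blast
qed

end
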